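(* Let $X=(x_j:0\le j\le N)$ be a partition of $[a,b]$. For every $\alpha>0$ and every data set $Y=(y_j:0\le j\le N)$ of real numbers, there is exactly one $s_\alpha[Y]\in S_\alpha^1(X)$ with $s_\alpha[Y](x_j)=y_j$ for all $0\le j\le N$, and exactly one $t_\alpha[Y]\in T_\alpha^1(X)$ with $t_\alpha[Y](x_j)=y_j$ for all $0\le j\le N$. Furthermore, for all $x\in[a,b]$, $$\lim_{\alpha\to0}s_\alpha[Y](x)=l[Y](x)\quad\text{and}\quad \lim_{\alpha\to0}t_\alpha[Y](x)=l[Y](x),$$ where $l[Y]$ is the linear spline interpolant, i.e. the continuous function on $[a,b]$ that is affine on each $[x_{j-1},x_j]$ and satisfies $l[Y](x_j)=y_j$ for $0\le j\le N$.
   Context: A partition of $[a,b]$ is a sequence $X=(x_j:0\le j\le N)$ with $a=x_0<x_1<\cdots<x_N=b$. For $\alpha>0$ (with $D=d/dx$), the first order polyhyperbolic splines are $$S_\alpha^1(X)=\{s\in C[a,b]:(D^2-\alpha^2)s=0\text{ on }[a,b]\setminus X\},$$ i.e. continuous functions which on each $[x_{j-1},x_j]$ have the form $p\cosh(\alpha x)+q\sinh(\alpha x)$ with constants $p,q$. Also $$T_\alpha^1(X)=\{\operatorname{sech}(\alpha\,\cdot)\,u:u\in S_\alpha^1(X)\},$$ i.e. continuous functions which on each $[x_{j-1},x_j]$ have the form $p+q\tanh(\alpha x)$ with constants $p,q$. *)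

theory Defs
  imports "HOL-Analysis.Analysis"
begin

definition partition_of :: "real \<Rightarrow> real \<Rightarrow> nat \<Rightarrow> (nat \<Rightarrow> real) \<Rightarrow> bool" where
  "partition_of a b N x \<longleftrightarrow> x 0 = a \<and> x N = b \<and> (\<forall>j<N. x j < x (Suc j))"

text \<open>
  Functions on [a,b] are represented by the elements of \<^term>\<open>extensional {a..b}\<close>, so that
  equality of functions on [a,b] is HOL equality.
\<close>

definition C_on :: "real \<Rightarrow> real \<Rightarrow> (real \<Rightarrow> real) set" where
  "C_on a b = {s \<in> extensional {a..b}. continuous_on {a..b} s}"

text \<open>
  Since a and b are nodes, the set of non-nodes in [a,b] is open, so the two-sided derivatives
  below involve only values of s (and of its first derivative s') inside that set.
\<close>

definition poly_hyp_spline ::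
    "real \<Rightarrow> real \<Rightarrow> nat \<Rightarrow> (nat \<Rightarrow> real) \<Rightarrow> real \<Rightarrow> (real \<Rightarrow> real) set" where
  "poly_hyp_spline a b N x \<alpha> =
    {s \<in> C_on a b. \<exists>s'. \<forall>t \<in> {a..b} - x ` {..N}.
       (s has_real_derivative s' t) (at t) \<and>
       (\<exists>d. (s' has_real_derivative d) (at t) \<and> d - \<alpha>\<^sup>2 * s t = 0)}"

definition sech :: "real \<Rightarrow> real" where
  "sech t = 1 / cosh t"

definition sech_spline ::
    "real \<Rightarrow> real \<Rightarrow> nat \<Rightarrow> (nat \<Rightarrow> real) \<Rightarrow> real \<Rightarrow> (real \<Rightarrow> real) set" where
  "sech_spline a b N x \<alpha> =
    {restrict (\<lambda>t. sech (\<alpha> * t) * u t) {a..b} |u. u \<in> poly_hyp_spline a b N x \<alpha>}"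

definition linear_spline ::
    "real \<Rightarrow> real \<Rightarrow> nat \<Rightarrow> (nat \<Rightarrow> real) \<Rightarrow> (real \<Rightarrow> real) set" where
  "linear_spline a b N x =
    {l \<in> C_on a b. \<forall>j<N. \<exists>p q. \<forall>t \<in> {x j..x (Suc j)}. l t = p + q * t}"

definition interpolates ::
    "nat \<Rightarrow> (nat \<Rightarrow> real) \<Rightarrow> (nat \<Rightarrow> real) \<Rightarrow> (real \<Rightarrow> real) \<Rightarrow> bool" where
  "interpolates N x y s \<longleftrightarrow> (\<forall>j\<le>N. s (x j) = y j)"

definition interpolant ::
    "(real \<Rightarrow> real) set \<Rightarrow> nat \<Rightarrow> (nat \<Rightarrow> real) \<Rightarrow> (nat \<Rightarrow> real) \<Rightarrow> real \<Rightarrow> real" where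
  "interpolant F N x y = (THE s. s \<in> F \<and> interpolates N x y s)"

end

(* On a knot interval [u, v] a solution of s'' = alpha^2 s is determined by its boundary values:
     s t * sinh (alpha (v - u)) = s u * sinh (alpha (v - t)) + s v * sinh (alpha (t - u)).
   Hence an interpolant is obtained by gluing these explicit pieces, and it is the only one. Since
   sinh (alpha A) / sinh (alpha B) tends to A / B, each piece tends to the affine interpolant as
   alpha tends to 0. Division by cosh (alpha x) maps the interpolants of the data
   cosh (alpha x_j) y_j to the interpolants of the data y_j in the sech-weighted space. *)

theory Submission
  imports Defs
begin

section \<open>Partitions and gluing\<close>

lemma partition_mono:
  assumes "partition_of a b N x" "i \<le> j" "j \<le> N"
  shows "x i \<le> x j"
  using assms(2,3)
proof (induction j rule: dec_induct)
  case (step n)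
  then have "x n < x (Suc n)" using assms(1) by (auto simp: partition_of_def)
  with step show ?case by auto
qed simp

lemma partition_nodes:
  assumes "partition_of a b N x" "j \<le> N"
  shows "x j \<in> {a..b}"
  using partition_mono[OF assms(1), of 0 j] partition_mono[OF assms(1), of j N] assms
  by (auto simp: partition_of_def)

lemma partition_cover:
  assumes "partition_of a b N x" "t \<in> {a..b}" "t \<noteq> b"
  obtains j where "j < N" "x j \<le> t" "t < x (Suc j)"
proof -
  have "\<exists>j. j < N \<and> x j \<le> t \<and> t < x (Suc j)"
  proof -
    have b: "t < x N" and a: "x 0 \<le> t" using assms by (auto simp: partition_of_def)
    \<comment> \<open>The first node beyond t ends the wanted segment. It exists because t < b =
      \<open>x N\<close>, and its index is positive because \<open>x 0\<close> = a \<le> t, so it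
      has a predecessor.\<close>
    define k where "k = (LEAST k. t < x k)"
    have k: "t < x k" "k \<le> N" unfolding k_def using b by (auto intro: LeastI Least_le)
    then obtain j where j: "k = Suc j" using a by (cases k) auto
    then have "\<not> t < x j" using not_less_Least[of j "\<lambda>k. t < x k"] k_def by auto
    with k j show ?thesis by (intro exI[of _ j]) auto
  qed
  with that show thesis by blast
qed

text \<open>Monotonicity puts every node on one side of the open segment, so the differential
  equation, imposed off the nodes, is available on all of it.\<close>

lemma partition_open_segment:
  assumes "partition_of a b N x" "j < N" "t \<in> {x j<..<x (Suc j)}"
  shows "t \<in> {a..b} - x ` {..N}"
proof -
  have "t \<noteq> x i" if "i \<le> N" for i
    using partition_mono[OF assms(1), of i j] partition_mono[OF assms(1), of "Suc j" i] assms that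
    by (cases "i \<le> j") auto
  moreover have "t \<in> {a..b}"
    using partition_nodes[OF assms(1), of j] partition_nodes[OF assms(1), of "Suc j"] assms by auto
  ultimately show ?thesis by blast
qed

text \<open>
  Clamping the argument to each segment makes the glued function a telescoping sum, continuous
  without any case distinction at the nodes.
\<close>

definition glue ::
    "real \<Rightarrow> real \<Rightarrow> nat \<Rightarrow> (nat \<Rightarrow> real) \<Rightarrow> (nat \<Rightarrow> real) \<Rightarrow> (nat \<Rightarrow> real \<Rightarrow> real) \<Rightarrow> real \<Rightarrow> real" where
  "glue a b N x y g =
    restrict (\<lambda>t. y 0 + (\<Sum>j<N. g j (max (x j) (min (x (Suc j)) t)) - y j)) {a..b}"

text \<open>Neighbouring pieces then meet at their common node, and each summand of
  \<open>glue\<close> is constant on either side of its segment.\<close>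

definition matches :: "nat \<Rightarrow> (nat \<Rightarrow> real) \<Rightarrow> (nat \<Rightarrow> real) \<Rightarrow> (nat \<Rightarrow> real \<Rightarrow> real) \<Rightarrow> bool" where
  "matches N x y g \<longleftrightarrow> (\<forall>j<N. g j (x j) = y j \<and> g j (x (Suc j)) = y (Suc j))"

text \<open>Clamping sends t to the right end of every earlier segment and to the left end of every
  later one. The earlier summands telescope to \<open>y j - y 0\<close>, the later ones vanish, and
  segment j contributes \<open>g j t - y j\<close>.\<close>

lemma glue_eq:
  assumes P: "partition_of a b N x" and M: "matches N x y g"
    and j: "j < N" and t: "t \<in> {x j..x (Suc j)}"
  shows "glue a b N x y g t = g j t"
proof -
  have ab: "t \<in> {a..b}"
    using partition_nodes[OF P, of j] partition_nodes[OF P, of "Suc j"] j t by auto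
  let ?f = "\<lambda>i. g i (max (x i) (min (x (Suc i)) t)) - y i"
  have lo: "?f i = y (Suc i) - y i" if "i < j" for i
  proof -
    have "x i \<le> x (Suc i)" "x (Suc i) \<le> t"
      using partition_mono[OF P, of i "Suc i"] partition_mono[OF P, of "Suc i" j] that j t by auto
    then show ?thesis using M that j by (auto simp: matches_def)
  qed
  have hi: "?f i = 0" if "i \<in> {Suc j..<N}" for i
  proof -
    have "x i \<le> x (Suc i)" "t \<le> x i"
      using partition_mono[OF P, of i "Suc i"] partition_mono[OF P, of "Suc j" i] that j t by auto
    then show ?thesis using M that by (auto simp: matches_def)
  qed
  have mid: "?f j = g j t - y j" using t by auto
  have disj: "{..<j} \<inter> {Suc j..<N} = {}" by auto
  have "{..<N} = {..<j} \<union> insert j {Suc j..<N}" using j by auto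
  then have "(\<Sum>i<N. ?f i) = (\<Sum>i<j. ?f i) + (?f j + (\<Sum>i\<in>{Suc j..<N}. ?f i))"
    using disj by (simp add: sum.union_disjoint)
  also have "\<dots> = (\<Sum>i<j. y (Suc i) - y i) + (g j t - y j)"
    using lo hi mid by simp
  also have "\<dots> = g j t - y 0" by (simp add: sum_lessThan_telescope)
  finally show ?thesis using ab by (simp add: glue_def)
qed

lemma glue_interpolates:
  assumes P: "partition_of a b N x" and M: "matches N x y g"
  shows "interpolates N x y (glue a b N x y g)"
  unfolding interpolates_def
proof (intro allI impI)
  fix j assume j: "j \<le> N"
  show "glue a b N x y g (x j) = y j"
  proof (cases j)
    case 0
    show ?thesis
    \<comment> \<open>With N = 0 there is no segment to evaluate on; the empty sum leaves
      \<open>y 0\<close>.\<close>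
    proof (cases "N = 0")
      case True
      with 0 P show ?thesis by (auto simp: glue_def partition_of_def)
    next
      case False
      then show ?thesis
        using glue_eq[OF P M, of 0 "x 0"] partition_mono[OF P, of 0 1] M 0
        by (auto simp: matches_def)
    qed
  next
    case (Suc i)
    \<comment> \<open>A later node is read as the right end of the preceding segment; this covers
      \<open>x N\<close>, where no segment begins.\<close>
    then show ?thesis
      using glue_eq[OF P M, of i "x j"] partition_mono[OF P, of i j] M j
      by (auto simp: matches_def)
  qed
qed

lemma glue_in_C_on:
  assumes "partition_of a b N x" "\<And>j. j < N \<Longrightarrow> continuous_on UNIV (g j)"
  shows "glue a b N x y g \<in> C_on a b"
proof -
  have "continuous_on {a..b}
      (\<lambda>t. y 0 + (\<Sum>j<N. g j (max (x j) (min (x (Suc j)) t)) - y j))"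
    by (intro continuous_intros continuous_on_compose2[OF assms(2)]) auto
  then have "continuous_on {a..b} (glue a b N x y g)"
    by (rule continuous_on_cong[THEN iffD1, rotated 2]) (auto simp: glue_def)
  then show ?thesis by (auto simp: C_on_def glue_def)
qed

lemma glue_unique:
  assumes P: "partition_of a b N x" and M: "matches N x y g"
    and s: "s \<in> extensional {a..b}" "interpolates N x y s"
    and eq: "\<And>j t. j < N \<Longrightarrow> t \<in> {x j..x (Suc j)} \<Longrightarrow> s t = g j t"
  shows "s = glue a b N x y g"
proof (rule extensionalityI[OF s(1)])
  fix t assume t: "t \<in> {a..b}"
  show "s t = glue a b N x y g t"
  \<comment> \<open>The half-open segments of \<open>partition_cover\<close> miss b; being the node
    \<open>x N\<close>, it is settled by interpolation.\<close>
  proof (cases "t = b")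
    case True
    then show ?thesis using s(2) glue_interpolates[OF P M] P
      by (auto simp: interpolates_def partition_of_def)
  next
    case False
    with partition_cover[OF P t] obtain j where "j < N" "x j \<le> t" "t < x (Suc j)" by metis
    then show ?thesis using eq glue_eq[OF P M, of j t] by auto
  qed
qed (simp add: glue_def)

section \<open>Hyperbolic and affine pieces\<close>

text \<open>Lagrange form for s'' = \<alpha>^2 s: one sinh term vanishes at v and the other at u, so
  for \<alpha> > 0 and u < v the boundary values are c and d.\<close>

definition hyp_piece :: "real \<Rightarrow> real \<Rightarrow> real \<Rightarrow> real \<Rightarrow> real \<Rightarrow> real \<Rightarrow> real" where
  "hyp_piece \<alpha> u v c d t =
    (c * sinh (\<alpha> * (v - t)) + d * sinh (\<alpha> * (t - u))) / sinh (\<alpha> * (v - u))"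

definition affine_piece :: "real \<Rightarrow> real \<Rightarrow> real \<Rightarrow> real \<Rightarrow> real \<Rightarrow> real" where
  "affine_piece u v c d t = (c * (v - t) + d * (t - u)) / (v - u)"

definition hyp_pieces :: "(nat \<Rightarrow> real) \<Rightarrow> (nat \<Rightarrow> real) \<Rightarrow> real \<Rightarrow> nat \<Rightarrow> real \<Rightarrow> real" where
  "hyp_pieces x y \<alpha> j = hyp_piece \<alpha> (x j) (x (Suc j)) (y j) (y (Suc j))"

definition affine_pieces :: "(nat \<Rightarrow> real) \<Rightarrow> (nat \<Rightarrow> real) \<Rightarrow> nat \<Rightarrow> real \<Rightarrow> real" where
  "affine_pieces x y j = affine_piece (x j) (x (Suc j)) (y j) (y (Suc j))"

lemma matches_hyp_pieces:
  assumes "partition_of a b N x" "\<alpha> > 0"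
  shows "matches N x y (hyp_pieces x y \<alpha>)"
  using assms by (auto simp: matches_def hyp_pieces_def hyp_piece_def partition_of_def)

lemma matches_affine_pieces:
  assumes "partition_of a b N x"
  shows "matches N x y (affine_pieces x y)"
  using assms by (fastforce simp: matches_def affine_pieces_def affine_piece_def partition_of_def)

lemma continuous_on_hyp_piece: "continuous_on S (hyp_piece \<alpha> u v c d)"
proof (cases "sinh (\<alpha> * (v - u)) = 0")
  \<comment> \<open>Division by zero yields 0, so the degenerate piece is the zero function.\<close>
  case True
  then have "hyp_piece \<alpha> u v c d = (\<lambda>t. 0)" by (auto simp: hyp_piece_def)
  then show ?thesis by simp
next
  case False
  show ?thesis unfolding hyp_piece_def using False by (intro continuous_intros) auto
qed

lemma continuous_on_affine_piece: "u \<noteq> v \<Longrightarrow> continuous_on S (affine_piece u v c d)"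
  unfolding affine_piece_def by (intro continuous_intros) auto

lemma hyp_piece_derivs:
  shows "(hyp_piece \<alpha> u v c d has_real_derivative
           \<alpha> * (d * cosh (\<alpha> * (t - u)) - c * cosh (\<alpha> * (v - t))) / sinh (\<alpha> * (v - u))) (at t)"
    and "((\<lambda>t. \<alpha> * (d * cosh (\<alpha> * (t - u)) - c * cosh (\<alpha> * (v - t))) / sinh (\<alpha> * (v - u)))
           has_real_derivative \<alpha>\<^sup>2 * hyp_piece \<alpha> u v c d t) (at t)"
  \<comment> \<open>Multiplying by a constant inverse avoids the side condition of a nonzero
    denominator.\<close>
  unfolding hyp_piece_def divide_inverse
  by (auto intro!: derivative_eq_intros simp: algebra_simps power2_eq_square)

lemma affine_determined:
  fixes p q u v t :: real
  assumes "u < v"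
  shows "p + q * t = affine_piece u v (p + q * u) (p + q * v) t"
  using assms by (simp add: affine_piece_def field_simps)

text \<open>After clearing the denominator, the subtraction formula for sinh leaves a polynomial
  identity in hyperbolic values. Trading the unknown p and q for endpoint values gives uniqueness on
  a segment.\<close>

lemma hyperbolic_determined:
  fixes p q u v t \<alpha> :: real
  assumes "\<alpha> > 0" "u < v"
  shows "p * cosh (\<alpha> * t) + q * sinh (\<alpha> * t) =
    hyp_piece \<alpha> u v (p * cosh (\<alpha> * u) + q * sinh (\<alpha> * u)) (p * cosh (\<alpha> * v) + q * sinh (\<alpha> * v)) t"
proof -
  have nz: "sinh (\<alpha> * (v - u)) \<noteq> 0" using assms by simp
  have "(p * cosh (\<alpha> * t) + q * sinh (\<alpha> * t)) * sinh (\<alpha> * (v - u)) =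
    (p * cosh (\<alpha> * u) + q * sinh (\<alpha> * u)) * sinh (\<alpha> * (v - t)) +
    (p * cosh (\<alpha> * v) + q * sinh (\<alpha> * v)) * sinh (\<alpha> * (t - u))"
    by (simp add: right_diff_distrib sinh_diff) (simp add: algebra_simps)
  with nz show ?thesis by (simp add: hyp_piece_def field_simps)
qed

text \<open>
  Variation of constants: the coefficients of cosh and sinh, solved from s and its first
  derivative, have vanishing derivative on the open interval.
\<close>

lemma ode_solution_form:
  fixes u v \<alpha> :: real
  assumes "\<alpha> > 0" "u < v" and cont: "continuous_on {u..v} s"
    and s': "\<And>t. t \<in> {u<..<v} \<Longrightarrow> (s has_real_derivative s' t) (at t)"
    and s'': "\<And>t. t \<in> {u<..<v} \<Longrightarrow> (s' has_real_derivative \<alpha>\<^sup>2 * s t) (at t)"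
  obtains p q where "\<And>t. t \<in> {u..v} \<Longrightarrow> s t = p * cosh (\<alpha> * t) + q * sinh (\<alpha> * t)"
proof -
  define A where "A = (\<lambda>t. s t * cosh (\<alpha> * t) - s' t * sinh (\<alpha> * t) / \<alpha>)"
  define B where "B = (\<lambda>t. s' t * cosh (\<alpha> * t) / \<alpha> - s t * sinh (\<alpha> * t))"
  have dA: "(A has_real_derivative 0) (at t within {u<..<v})" if "t \<in> {u<..<v}" for t
  proof -
    have "(A has_real_derivative 0) (at t)"
      unfolding A_def using \<open>\<alpha> > 0\<close>
      by (auto intro!: derivative_eq_intros s'[OF that] s''[OF that]
          simp: field_simps power2_eq_square)
    then show ?thesis by (rule has_field_derivative_at_within)
  qed
  have dB: "(B has_real_derivative 0) (at t within {u<..<v})" if "t \<in> {u<..<v}" for t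
  proof -
    have "(B has_real_derivative 0) (at t)"
      unfolding B_def using \<open>\<alpha> > 0\<close>
      by (auto intro!: derivative_eq_intros s'[OF that] s''[OF that]
          simp: field_simps power2_eq_square)
    then show ?thesis by (rule has_field_derivative_at_within)
  qed
  obtain p where p: "\<And>t. t \<in> {u<..<v} \<Longrightarrow> A t = p"
    using has_field_derivative_zero_constant[of "{u<..<v}" A] dA by auto
  obtain q where q: "\<And>t. t \<in> {u<..<v} \<Longrightarrow> B t = q"
    using has_field_derivative_zero_constant[of "{u<..<v}" B] dB by auto
  define f where "f = (\<lambda>t. s t - (p * cosh (\<alpha> * t) + q * sinh (\<alpha> * t)))"
  have f0: "f t = 0" if "t \<in> {u<..<v}" for t
  proof -
    \<comment> \<open>The terms with \<open>s'\<close> cancel, and cosh^2 - sinh^2 = 1 then recovers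
      s.\<close>
    have "A t * cosh (\<alpha> * t) + B t * sinh (\<alpha> * t) = s t * ((cosh (\<alpha> * t))\<^sup>2 - (sinh (\<alpha> * t))\<^sup>2)"
      by (simp add: A_def B_def algebra_simps power2_eq_square)
    then show ?thesis using p[OF that] q[OF that] by (simp add: f_def hyperbolic_pythagoras)
  qed
  \<comment> \<open>The equation holds only inside the interval; continuity carries f = 0 to the
    endpoints.\<close>
  have "continuous_on (closure {u<..<v}) f"
    unfolding f_def closure_greaterThanLessThan[OF \<open>u < v\<close>]
    by (intro continuous_intros cont)
  then have "f t = 0" if "t \<in> {u..v}" for t
    using continuous_constant_on_closure[of "{u<..<v}" f 0 t] f0 that
    by (simp add: closure_greaterThanLessThan[OF \<open>u < v\<close>])
  with that show thesis by (simp add: f_def)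
qed

section \<open>The interpolants\<close>

text \<open>The equivalence form yields existence, uniqueness and the value of
  \<open>interpolant\<close> at once.\<close>

lemma poly_hyp_spline_interpolant_iff:
  assumes P: "partition_of a b N x" and \<alpha>: "\<alpha> > 0"
  shows "s \<in> poly_hyp_spline a b N x \<alpha> \<and> interpolates N x y s \<longleftrightarrow>
    s = glue a b N x y (hyp_pieces x y \<alpha>)"
proof
  note M = matches_hyp_pieces[OF P \<alpha>, of y]
  assume s: "s \<in> poly_hyp_spline a b N x \<alpha> \<and> interpolates N x y s"
  then have C: "s \<in> extensional {a..b}" "continuous_on {a..b} s"
    by (auto simp: poly_hyp_spline_def C_on_def)
  obtain s' where ode: "\<forall>t \<in> {a..b} - x ` {..N}. (s has_real_derivative s' t) (at t) \<and>
       (\<exists>d. (s' has_real_derivative d) (at t) \<and> d - \<alpha>\<^sup>2 * s t = 0)"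
    using s unfolding poly_hyp_spline_def by blast
  have s': "(s has_real_derivative s' t) (at t) \<and> (s' has_real_derivative \<alpha>\<^sup>2 * s t) (at t)"
    if "t \<in> {a..b} - x ` {..N}" for t
    using ode[rule_format, OF that] by auto
  show "s = glue a b N x y (hyp_pieces x y \<alpha>)"
  proof (rule glue_unique[OF P M C(1)])
    fix j t assume j: "j < N" and t: "t \<in> {x j..x (Suc j)}"
    have lt: "x j < x (Suc j)" using P j by (auto simp: partition_of_def)
    have "{x j..x (Suc j)} \<subseteq> {a..b}"
      using partition_nodes[OF P, of j] partition_nodes[OF P, of "Suc j"] j by auto
    then obtain p q where
      pq: "\<And>t. t \<in> {x j..x (Suc j)} \<Longrightarrow> s t = p * cosh (\<alpha> * t) + q * sinh (\<alpha> * t)"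
      using ode_solution_form[OF \<alpha> lt, of s s'] s' partition_open_segment[OF P j]
        continuous_on_subset[OF C(2)] by blast
    have "s (x j) = y j" "s (x (Suc j)) = y (Suc j)"
      using s j by (auto simp: interpolates_def)
    then show "s t = hyp_pieces x y \<alpha> j t"
      using hyperbolic_determined[OF \<alpha> lt, of p t q] pq[OF t] pq[of "x j"] pq[of "x (Suc j)"] lt
      by (simp add: hyp_pieces_def)
  qed (use s in auto)
next
  note M = matches_hyp_pieces[OF P \<alpha>, of y]
  assume s: "s = glue a b N x y (hyp_pieces x y \<alpha>)"
  have C: "s \<in> C_on a b"
    unfolding s by (rule glue_in_C_on[OF P]) (simp add: hyp_pieces_def continuous_on_hyp_piece)
  \<comment> \<open>One derivative function must serve all segments. The global choice
    \<open>deriv s\<close> agrees with the explicit \<open>?h'\<close> on each open segment, so its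
    derivative can be read off there.\<close>
  have "(s has_real_derivative deriv s t) (at t) \<and>
      (deriv s has_real_derivative \<alpha>\<^sup>2 * s t) (at t)" if t: "t \<in> {a..b} - x ` {..N}" for t
  proof -
    have "t \<noteq> b" using t P by (auto simp: partition_of_def)
    then obtain j where j: "j < N" "x j \<le> t" "t < x (Suc j)"
      using partition_cover[OF P] t by blast
    have "t \<noteq> x j" using t j(1) by auto
    then have tj: "t \<in> {x j<..<x (Suc j)}" using j by auto
    let ?h = "hyp_piece \<alpha> (x j) (x (Suc j)) (y j) (y (Suc j))"
    let ?h' = "\<lambda>t. \<alpha> * (y (Suc j) * cosh (\<alpha> * (t - x j)) - y j * cosh (\<alpha> * (x (Suc j) - t)))
                / sinh (\<alpha> * (x (Suc j) - x j))"
    have eq: "?h r = s r" if "r \<in> {x j<..<x (Suc j)}" for r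
      using glue_eq[OF P M j(1), of r] that by (simp add: s hyp_pieces_def)
    have d: "(s has_real_derivative ?h' r) (at r)" if "r \<in> {x j<..<x (Suc j)}" for r
      by (rule has_field_derivative_transform_within_open[OF hyp_piece_derivs(1) _ that eq]) auto
    have "(deriv s has_real_derivative \<alpha>\<^sup>2 * ?h t) (at t)"
      by (rule has_field_derivative_transform_within_open[OF hyp_piece_derivs(2) _ tj])
        (auto intro!: DERIV_imp_deriv[OF d, symmetric])
    then show ?thesis using d[OF tj] DERIV_imp_deriv[OF d[OF tj]] eq[OF tj] by simp
  qed
  then have "\<forall>t \<in> {a..b} - x ` {..N}. (s has_real_derivative deriv s t) (at t) \<and>
       (\<exists>d. (deriv s has_real_derivative d) (at t) \<and> d - \<alpha>\<^sup>2 * s t = 0)"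
    by fastforce
  with C have "s \<in> poly_hyp_spline a b N x \<alpha>" unfolding poly_hyp_spline_def by blast
  with glue_interpolates[OF P M]
  show "s \<in> poly_hyp_spline a b N x \<alpha> \<and> interpolates N x y s" by (simp add: s)
qed

lemma sech_spline_interpolant_iff:
  fixes y :: "nat \<Rightarrow> real"
  assumes P: "partition_of a b N x" and \<alpha>: "\<alpha> > 0"
  defines "w \<equiv> \<lambda>j. cosh (\<alpha> * x j) * y j"
  shows "t \<in> sech_spline a b N x \<alpha> \<and> interpolates N x y t \<longleftrightarrow>
    t = restrict (\<lambda>z. sech (\<alpha> * z) * glue a b N x w (hyp_pieces x w \<alpha>) z) {a..b}"
proof -
  \<comment> \<open>Nodes lie in [a,b], where \<open>restrict\<close> has no effect, and cosh is
    nonzero, so the weight moves to the data.\<close>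
  have *: "interpolates N x y (restrict (\<lambda>z. sech (\<alpha> * z) * u z) {a..b}) \<longleftrightarrow> interpolates N x w u"
    for u
    using partition_nodes[OF P]
    by (auto simp: interpolates_def w_def sech_def field_simps)
  have "t \<in> sech_spline a b N x \<alpha> \<and> interpolates N x y t \<longleftrightarrow>
      (\<exists>u. t = restrict (\<lambda>z. sech (\<alpha> * z) * u z) {a..b} \<and>
        u \<in> poly_hyp_spline a b N x \<alpha> \<and> interpolates N x w u)"
    unfolding sech_spline_def using * by auto
  \<comment> \<open>The data \<open>w\<close> determine u, so the existential collapses to one
    function.\<close>
  then show ?thesis
    by (simp add: poly_hyp_spline_interpolant_iff[OF P \<alpha>])
qed

lemma linear_spline_interpolant_iff:
  assumes P: "partition_of a b N x"
  shows "l \<in> linear_spline a b N x \<and> interpolates N x y l \<longleftrightarrow>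
    l = glue a b N x y (affine_pieces x y)"
proof
  note M = matches_affine_pieces[OF P, of y]
  assume l: "l \<in> linear_spline a b N x \<and> interpolates N x y l"
  show "l = glue a b N x y (affine_pieces x y)"
  proof (rule glue_unique[OF P M])
    fix j t assume j: "j < N" and t: "t \<in> {x j..x (Suc j)}"
    have lt: "x j < x (Suc j)" using P j by (auto simp: partition_of_def)
    obtain p q where pq: "\<And>t. t \<in> {x j..x (Suc j)} \<Longrightarrow> l t = p + q * t"
      using l j unfolding linear_spline_def by blast
    have "l (x j) = y j" "l (x (Suc j)) = y (Suc j)"
      using l j by (auto simp: interpolates_def)
    then show "l t = affine_pieces x y j t"
      using affine_determined[OF lt, of p q t] pq[OF t] pq[of "x j"] pq[of "x (Suc j)"] lt
      by (simp add: affine_pieces_def)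
  qed (use l in \<open>auto simp: linear_spline_def C_on_def\<close>)
next
  note M = matches_affine_pieces[OF P, of y]
  assume l: "l = glue a b N x y (affine_pieces x y)"
  have "l \<in> C_on a b"
    unfolding l using P
    by (intro glue_in_C_on[OF P])
      (auto simp: affine_pieces_def partition_of_def intro!: continuous_on_affine_piece
        dest: less_imp_neq)
  moreover have "\<exists>p q. \<forall>t \<in> {x j..x (Suc j)}. l t = p + q * t" if "j < N" for j
  proof (intro exI ballI)
    fix t assume "t \<in> {x j..x (Suc j)}"
    then have "l t = affine_pieces x y j t" using glue_eq[OF P M that] l by simp
    \<comment> \<open>Intercept and slope come from collecting powers of t in
      \<open>affine_piece\<close>.\<close>
    then show "l t = (y j * x (Suc j) - y (Suc j) * x j) / (x (Suc j) - x j)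
        + (y (Suc j) - y j) / (x (Suc j) - x j) * t"
      by (simp add: affine_pieces_def affine_piece_def add_divide_distrib diff_divide_distrib
          algebra_simps)
  qed
  ultimately show "l \<in> linear_spline a b N x \<and> interpolates N x y l"
    using glue_interpolates[OF P M] l by (simp add: linear_spline_def)
qed

lemma interpolant_eqI:
  assumes "\<And>s. s \<in> F \<and> interpolates N x y s \<longleftrightarrow> s = g"
  shows "interpolant F N x y = g"
  using assms by (simp add: interpolant_def)

section \<open>The limit\<close>

text \<open>This is the difference quotient at 0 of \<open>sinh (\<alpha> * A)\<close> as a function
  of \<alpha>.\<close>

lemma tendsto_sinh_over_param: "((\<lambda>\<alpha>. sinh (\<alpha> * A) / \<alpha>) \<longlongrightarrow> (A::real)) (at_right 0)"
proof -
  have "((\<lambda>\<alpha>. sinh (\<alpha> * A)) has_real_derivative A) (at 0)"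
    by (auto intro!: derivative_eq_intros)
  then have "((\<lambda>\<alpha>. sinh (\<alpha> * A) / \<alpha>) \<longlongrightarrow> A) (at 0)"
    by (simp add: DERIV_def)
  then show ?thesis by (rule tendsto_within_subset) simp
qed

text \<open>The boundary values may vary with \<alpha> because the sech-weighted case interpolates
  the data cosh(\<alpha> x_j) y_j.\<close>

lemma tendsto_hyp_piece:
  assumes "u < v" "(c \<longlongrightarrow> c0) (at_right 0)" "(d \<longlongrightarrow> d0) (at_right 0)"
  shows "((\<lambda>\<alpha>. hyp_piece \<alpha> u v (c \<alpha>) (d \<alpha>) t) \<longlongrightarrow> affine_piece u v c0 d0 t) (at_right 0)"
proof -
  \<comment> \<open>Dividing numerator and denominator by \<alpha> makes every factor converge, the
    denominator to v - u, which is nonzero.\<close>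
  have "((\<lambda>\<alpha>. (c \<alpha> * (sinh (\<alpha> * (v - t)) / \<alpha>) + d \<alpha> * (sinh (\<alpha> * (t - u)) / \<alpha>))
      / (sinh (\<alpha> * (v - u)) / \<alpha>)) \<longlongrightarrow> affine_piece u v c0 d0 t) (at_right 0)"
    unfolding affine_piece_def
    by (intro tendsto_intros assms(2,3) tendsto_sinh_over_param) (use \<open>u < v\<close> in auto)
  then show ?thesis
  proof (rule Lim_transform_eventually)
    show "\<forall>\<^sub>F \<alpha> in at_right 0.
      (c \<alpha> * (sinh (\<alpha> * (v - t)) / \<alpha>) + d \<alpha> * (sinh (\<alpha> * (t - u)) / \<alpha>))
        / (sinh (\<alpha> * (v - u)) / \<alpha>) = hyp_piece \<alpha> u v (c \<alpha>) (d \<alpha>) t"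
      using eventually_at_right_less
      by eventually_elim (simp add: hyp_piece_def add_divide_distrib[symmetric])
  qed
qed

text \<open>The clamped arguments do not depend on \<alpha>, so the limit passes through the finite
  sum term by term, without locating z in a segment.\<close>

lemma tendsto_glue_hyp_pieces:
  assumes P: "partition_of a b N x" and z: "z \<in> {a..b}"
    and y: "\<And>j. ((\<lambda>\<alpha>. y \<alpha> j) \<longlongrightarrow> y0 j) (at_right 0)"
  shows "((\<lambda>\<alpha>. glue a b N x (y \<alpha>) (hyp_pieces x (y \<alpha>) \<alpha>) z)
    \<longlongrightarrow> glue a b N x y0 (affine_pieces x y0) z) (at_right 0)"
  using z P unfolding glue_def restrict_def hyp_pieces_def affine_pieces_def
  by (simp, intro tendsto_intros tendsto_hyp_piece y) (auto simp: partition_of_def)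

theorem proposition1:
  fixes a b :: real and N :: nat and x y :: "nat \<Rightarrow> real"
  assumes "partition_of a b N x"
  shows "(\<forall>\<alpha>>0.
            (\<exists>!s. s \<in> poly_hyp_spline a b N x \<alpha> \<and> interpolates N x y s) \<and>
            (\<exists>!t. t \<in> sech_spline a b N x \<alpha> \<and> interpolates N x y t)) \<and>
         (\<forall>z\<in>{a..b}.
            ((\<lambda>\<alpha>. interpolant (poly_hyp_spline a b N x \<alpha>) N x y z)
               \<longlongrightarrow> interpolant (linear_spline a b N x) N x y z) (at_right 0) \<and>
            ((\<lambda>\<alpha>. interpolant (sech_spline a b N x \<alpha>) N x y z)
               \<longlongrightarrow> interpolant (linear_spline a b N x) N x y z) (at_right 0))"
proof (intro conjI allI impI ballI)
  fix \<alpha> :: real assume \<alpha>: "\<alpha> > 0"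
  show "\<exists>!s. s \<in> poly_hyp_spline a b N x \<alpha> \<and> interpolates N x y s"
    by (simp add: poly_hyp_spline_interpolant_iff[OF assms \<alpha>])
  show "\<exists>!t. t \<in> sech_spline a b N x \<alpha> \<and> interpolates N x y t"
    by (simp add: sech_spline_interpolant_iff[OF assms \<alpha>])
next
  fix z assume z: "z \<in> {a..b}"
  have lin: "interpolant (linear_spline a b N x) N x y = glue a b N x y (affine_pieces x y)"
    by (rule interpolant_eqI[OF linear_spline_interpolant_iff[OF assms]])
  \<comment> \<open>The closed forms of the interpolants are established for \<alpha> > 0, which
    holds eventually along \<open>at_right 0\<close>.\<close>
  have pos: "\<forall>\<^sub>F \<alpha> in at_right 0. (0::real) < \<alpha>" by (rule eventually_at_right_less)
  show "((\<lambda>\<alpha>. interpolant (poly_hyp_spline a b N x \<alpha>) N x y z)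
     \<longlongrightarrow> interpolant (linear_spline a b N x) N x y z) (at_right 0)"
  proof (rule Lim_transform_eventually)
    show "((\<lambda>\<alpha>. glue a b N x y (hyp_pieces x y \<alpha>) z)
       \<longlongrightarrow> interpolant (linear_spline a b N x) N x y z) (at_right 0)"
      unfolding lin by (rule tendsto_glue_hyp_pieces[OF assms z tendsto_const])
    show "\<forall>\<^sub>F \<alpha> in at_right 0. glue a b N x y (hyp_pieces x y \<alpha>) z =
        interpolant (poly_hyp_spline a b N x \<alpha>) N x y z"
      using pos
      by eventually_elim (simp add: interpolant_eqI[OF poly_hyp_spline_interpolant_iff[OF assms]])
  qed
  \<comment> \<open>These are the values that the polyhyperbolic factor must take at the nodes; they
    tend to \<open>y j\<close> because cosh tends to 1.\<close>
  let ?w = "\<lambda>\<alpha> j. cosh (\<alpha> * x j) * y j"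
  have cosh1: "((\<lambda>\<alpha>. cosh (\<alpha> * r)) \<longlongrightarrow> 1) (at_right 0)" for r :: real
  proof -
    have "((\<lambda>\<alpha>. cosh (\<alpha> * r)) \<longlongrightarrow> cosh (0 * r)) (at_right 0)" by (intro tendsto_intros)
    then show ?thesis by simp
  qed
  have sech1: "((\<lambda>\<alpha>. sech (\<alpha> * z)) \<longlongrightarrow> 1) (at_right 0)"
    using tendsto_divide[OF tendsto_const cosh1, of 1] by (simp add: sech_def)
  have w: "((\<lambda>\<alpha>. ?w \<alpha> j) \<longlongrightarrow> y j) (at_right 0)" for j
    using tendsto_mult[OF cosh1 tendsto_const] by fastforce
  show "((\<lambda>\<alpha>. interpolant (sech_spline a b N x \<alpha>) N x y z)
     \<longlongrightarrow> interpolant (linear_spline a b N x) N x y z) (at_right 0)"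
  proof (rule Lim_transform_eventually)
    show "((\<lambda>\<alpha>. sech (\<alpha> * z) * glue a b N x (?w \<alpha>) (hyp_pieces x (?w \<alpha>) \<alpha>) z)
       \<longlongrightarrow> interpolant (linear_spline a b N x) N x y z) (at_right 0)"
      using tendsto_mult[OF sech1 tendsto_glue_hyp_pieces[OF assms z w]] by (simp add: lin)
    show "\<forall>\<^sub>F \<alpha> in at_right 0. sech (\<alpha> * z) * glue a b N x (?w \<alpha>) (hyp_pieces x (?w \<alpha>) \<alpha>) z =
        interpolant (sech_spline a b N x \<alpha>) N x y z"
      using pos
    proof eventually_elim
      case (elim \<alpha>)
      show ?case
        using z by (simp add: interpolant_eqI[OF sech_spline_interpolant_iff[OF assms elim]])
    qed
  qed
qed

end
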